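(* Let $G$ be a locally compact group with identity $e$, equipped with a left-invariant Haar measure $\mu_G$, and let $(\{x_g\}_{g\in G},\{\tau_g\}_{g\in G})$ be a Parseval continuous frame for a Hilbert space $\mathcal{H}$ (indexed by $(G,\mu_G)$). Then there is a unitary representation $\pi$ of $G$ on $\mathcal{H}$ for which $$x_g=\pi_gx_e,\quad\tau_g=\pi_g\tau_e,\qquad\forall g\in G,$$ if and only if $$\langle x_{gp},x_{gq}\rangle=\langle x_p,x_q\rangle,\quad\langle x_{gp},\tau_{gq}\rangle=\langle x_p,\tau_q\rangle,\quad\langle\tau_{gp},\tau_{gq}\rangle=\langle\tau_p,\tau_q\rangle,\qquad\forall g,p,q\in G.$$
   Context: $\mathcal{H}$ is a Hilbert space over $\mathbb{K}\in\{\mathbb{R},\mathbb{C}\}$. All vector-valued integrals are weak: $\int_\Omega F\,d\mu$ is the element of $\mathcal{H}$ with $\langle\int_\Omega F\,d\mu,g\rangle=\int_\Omega\langle F(\alpha),g\rangle\,d\mu(\alpha)$ for all $g\in\mathcal{H}$. For a measure space $(\Omega,\mu)$ with positive measure, a family $\{x_\alpha\}_{\alpha\in\Omega}$ in $\mathcal{H}$ is a continuous frame with respect to a family $\{\tau_\alpha\}_{\alpha\in\Omega}$ in $\mathcal{H}$ (one says $(\{x_\alpha\}_{\alpha\in\Omega},\{\tau_\alpha\}_{\alpha\in\Omega})$ is a continuous frame for $\mathcal{H}$) if: (i) for each $h\in\mathcal{H}$ the maps $\alpha\mapsto\langle h,x_\alpha\rangle$ and $\alpha\mapsto\langle h,\tau_\alpha\rangle$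 are measurable; (ii) the frame operator $S_{x,\tau}:\mathcal{H}\ni h\mapsto\int_\Omega\langle h,x_\alpha\rangle\tau_\alpha\,d\mu(\alpha)\in\mathcal{H}$ is a well-defined bounded positive invertible operator; (iii) the analysis operators $\theta_x,\theta_\tau:\mathcal{H}\to\mathcal{L}^2(\Omega,\mathbb{K})$, $(\theta_xh)(\alpha)=\langle h,x_\alpha\rangle$, $(\theta_\tau h)(\alpha)=\langle h,\tau_\alpha\rangle$, are well-defined bounded linear operators. It is Parseval if $S_{x,\tau}=I_{\mathcal{H}}$. Here $\Omega=G$ and $\mu=\mu_G$. A unitary representation $\pi$ of $G$ on $\mathcal{H}$ is a homomorphism $g\mapsto\pi_g$ from $G$ to the unitary operators on $\mathcal{H}$ such that $g\mapsto\pi_gh$ is continuous for every $h\in\mathcal{H}$. *)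

theory Defs
  imports "HOL-Analysis.Analysis"
begin

text \<open>
  The scalar field: a complete normed field over the reals with a conjugation. The axioms force
  \<open>x\<^sup>2 - (x + kcnj x) x + \<bar>x\<bar>\<^sup>2 = 0\<close> with real coefficients, so the real and the complex
  numbers are, up to isomorphism, the only models; see \<open>rc_field_real_or_complex\<close>.
\<close>

class rc_field = real_normed_field + banach + second_countable_topology +
  fixes kcnj :: "'a \<Rightarrow> 'a"
  assumes kcnj_add: "kcnj (x + y) = kcnj x + kcnj y"
    and kcnj_mult: "kcnj (x * y) = kcnj x * kcnj y"
    and mult_kcnj_scaleR: "x * kcnj x = (norm x)\<^sup>2 *\<^sub>R 1"

lemma mult_kcnj: "x * kcnj x = of_real ((norm x)\<^sup>2)" for x :: "'k::rc_field"
  by (simp add: mult_kcnj_scaleR of_real_def)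

instantiation real :: rc_field
begin
definition kcnj_real :: "real \<Rightarrow> real" where "kcnj_real x = x"
instance by standard (simp_all add: kcnj_real_def power2_eq_square)
end

instantiation complex :: rc_field
begin
definition kcnj_complex :: "complex \<Rightarrow> complex" where "kcnj_complex = cnj"
instance by standard (simp_all add: kcnj_complex_def complex_norm_square scaleR_conv_of_real flip: of_real_power)
end

lemma rc_field_real_or_complex:
  "(\<forall>x::'k::rc_field. x \<in> \<real>) \<or>
   (\<exists>i::'k. i * i = - 1 \<and> (\<forall>x. \<exists>a b. x = of_real a + of_real b * i))"
proof (cases "\<forall>x::'k. x \<in> \<real>")
  case False
  have k0: "kcnj (0::'k) = 0"
    using kcnj_add[of "0::'k" 0] by simp
  have kr: "kcnj (of_real a :: 'k) = of_real a" for a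
  proof (cases "a = 0")
    case False
    have "of_real a * kcnj (of_real a :: 'k) = of_real a * of_real a"
      using mult_kcnj[of "of_real a :: 'k"] by (simp add: power2_eq_square flip: of_real_mult)
    then show ?thesis using False by simp
  qed (simp add: k0)
  have tr: "\<exists>t. x + kcnj x = of_real t" for x :: 'k
  proof
    have "(x + 1) * (kcnj x + 1) = of_real ((norm (x + 1))\<^sup>2)"
      using mult_kcnj[of "x + 1"] kr[of 1] by (simp add: kcnj_add)
    moreover have "(x + 1) * (kcnj x + 1) = of_real ((norm x)\<^sup>2) + (x + kcnj x) + 1"
      using mult_kcnj[of x] by (simp add: algebra_simps)
    ultimately show "x + kcnj x = of_real ((norm (x + 1))\<^sup>2 - (norm x)\<^sup>2 - 1)"
      by (simp add: algebra_simps)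
  qed
  have fixed: "x \<in> \<real>" if x: "kcnj x = x" for x :: 'k
  proof -
    obtain t where t: "x + x = of_real t" using tr[of x] unfolding x by blast
    have "x = (1 / 2) *\<^sub>R (x + x)" by (simp flip: scaleR_2)
    also have "\<dots> = of_real (t / 2)" unfolding t by (simp add: scaleR_conv_of_real)
    finally show ?thesis by (metis Reals_of_real)
  qed
  have split: "\<exists>a y. x = of_real a + y \<and> kcnj y = - y" for x :: 'k
  proof -
    obtain t where t: "x + kcnj x = of_real t" using tr by blast
    have "(of_real (t / 2) + of_real (t / 2) :: 'k) = of_real t"
      unfolding of_real_add[symmetric] by simp
    then have "kcnj x = of_real (t / 2) + of_real (t / 2) - x"
      using t by (metis add_diff_cancel_left')
    then have "kcnj (x + of_real (- (t / 2))) = - (x + of_real (- (t / 2)))"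
      unfolding kcnj_add kr by (simp del: of_real_divide)
    then show ?thesis
      by (intro exI[of _ "t / 2"] exI[of _ "x + of_real (- (t / 2))"]) simp
  qed
  obtain z :: 'k where z: "z \<notin> \<real>" using False by blast
  obtain c w where w: "z = of_real c + w" "kcnj w = - w" using split by blast
  have w0: "w \<noteq> 0" using z w by auto
  define i where "i = of_real (1 / norm w) * w"
  have "w * w = - of_real ((norm w)\<^sup>2)"
    using mult_kcnj[of w] w(2) by (metis minus_minus mult_minus_right)
  then have ii: "i * i = - 1"
    using w0 by (simp add: i_def field_simps power2_eq_square)
  have ki: "kcnj i = - i"
    unfolding i_def kcnj_mult kr w(2) by simp
  have "\<exists>a b. x = of_real a + of_real b * i" for x
  proof -
    obtain a y where y: "x = of_real a + y" "kcnj y = - y" using split by blast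
    have "kcnj (y * i) = y * i" by (simp add: kcnj_mult ki y(2))
    then obtain r where r: "y * i = of_real r" using fixed Reals_cases by metis
    have "y = - ((y * i) * i)" by (simp add: mult.assoc ii)
    then have "y = of_real (- r) * i" by (simp add: r)
    then show ?thesis using y by blast
  qed
  then show ?thesis using ii by blast
qed simp

text \<open>
  A Hilbert space over \<open>'k\<close>. Norm, topology and completeness are those of the underlying real
  Banach space \<open>'h\<close>; the inner product is linear in the first argument.
\<close>

locale hilbert_space = vector_space smul
  for smul :: "'k::rc_field \<Rightarrow> 'h::banach \<Rightarrow> 'h" +
  fixes ip :: "'h \<Rightarrow> 'h \<Rightarrow> 'k"
  assumes smul_of_real: "smul (of_real r) v = r *\<^sub>R v"
    and ip_add_left: "ip (u + v) w = ip u w + ip v w"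
    and ip_smul_left: "ip (smul c v) w = c * ip v w"
    and ip_commute: "ip w v = kcnj (ip v w)"
    and ip_self: "ip v v = of_real ((norm v)\<^sup>2)"

lemma hilbert_space_real: "hilbert_space scaleR (inner :: 'h::{real_inner, banach} \<Rightarrow> 'h \<Rightarrow> real)"
  by standard
    (simp_all add: kcnj_real_def inner_commute inner_add_left power2_norm_eq_inner algebra_simps)

lemma hilbert_space_complex: "hilbert_space (*) (\<lambda>z w. z * cnj w)"
  by standard
    (simp_all add: kcnj_complex_def scaleR_conv_of_real complex_norm_square [symmetric]
      algebra_simps del: of_real_power)

definition bounded_klinear :: "('k::rc_field \<Rightarrow> 'h::banach \<Rightarrow> 'h) \<Rightarrow> ('h \<Rightarrow> 'h) \<Rightarrow> bool" where
  "bounded_klinear smul T \<longleftrightarrow> bounded_linear T \<and> (\<forall>c v. T (smul c v) = smul c (T v))"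

definition is_adjoint :: "('h \<Rightarrow> 'h \<Rightarrow> 'k) \<Rightarrow> ('h \<Rightarrow> 'h) \<Rightarrow> ('h \<Rightarrow> 'h) \<Rightarrow> bool" where
  "is_adjoint ip T T' \<longleftrightarrow> (\<forall>u v. ip (T u) v = ip u (T' v))"

text \<open>Over the reals self-adjointness does not follow from nonnegativity of the quadratic form.\<close>

definition positive_op :: "('h \<Rightarrow> 'h \<Rightarrow> 'k::rc_field) \<Rightarrow> ('h \<Rightarrow> 'h) \<Rightarrow> bool" where
  "positive_op ip T \<longleftrightarrow> is_adjoint ip T T \<and> (\<forall>v. ip (T v) v \<in> \<real>\<^sub>\<ge>\<^sub>0)"

definition invertible_op :: "('k::rc_field \<Rightarrow> 'h::banach \<Rightarrow> 'h) \<Rightarrow> ('h \<Rightarrow> 'h) \<Rightarrow> bool" where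
  "invertible_op smul T \<longleftrightarrow> (\<exists>R. bounded_klinear smul R \<and> R \<circ> T = id \<and> T \<circ> R = id)"

definition unitary_op ::
  "('k::rc_field \<Rightarrow> 'h::banach \<Rightarrow> 'h) \<Rightarrow> ('h \<Rightarrow> 'h \<Rightarrow> 'k) \<Rightarrow> ('h \<Rightarrow> 'h) \<Rightarrow> bool" where
  "unitary_op smul ip U \<longleftrightarrow> bounded_klinear smul U \<and>
     (\<exists>U'. bounded_klinear smul U' \<and> is_adjoint ip U U' \<and> U' \<circ> U = id \<and> U \<circ> U' = id)"

definition has_weak_integral ::
  "('h \<Rightarrow> 'h \<Rightarrow> 'k::rc_field) \<Rightarrow> 'a measure \<Rightarrow> ('a \<Rightarrow> 'h) \<Rightarrow> 'h \<Rightarrow> bool" where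
  "has_weak_integral ip M F v \<longleftrightarrow>
     (\<forall>u. integrable M (\<lambda>\<alpha>. ip (F \<alpha>) u) \<and> ip v u = (\<integral>\<alpha>. ip (F \<alpha>) u \<partial>M))"

definition weak_integral ::
  "('h \<Rightarrow> 'h \<Rightarrow> 'k::rc_field) \<Rightarrow> 'a measure \<Rightarrow> ('a \<Rightarrow> 'h) \<Rightarrow> 'h" where
  "weak_integral ip M F = (THE v. has_weak_integral ip M F v)"

text \<open>
  Elements of \<open>L\<^sup>2\<close> are represented by square-integrable functions, identified when they agree
  almost everywhere; hence linearity of a map into \<open>L\<^sup>2\<close> is required almost everywhere.
\<close>

definition square_integrable :: "'a measure \<Rightarrow> ('a \<Rightarrow> 'k::rc_field) \<Rightarrow> bool" where
  "square_integrable M f \<longleftrightarrow> f \<in> borel_measurable M \<and> integrable M (\<lambda>\<alpha>. (norm (f \<alpha>))\<^sup>2)"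

definition L2_norm :: "'a measure \<Rightarrow> ('a \<Rightarrow> 'k::rc_field) \<Rightarrow> real" where
  "L2_norm M f = sqrt (\<integral>\<alpha>. (norm (f \<alpha>))\<^sup>2 \<partial>M)"

definition bounded_klinear_into_L2 ::
  "('k::rc_field \<Rightarrow> 'h::banach \<Rightarrow> 'h) \<Rightarrow> 'a measure \<Rightarrow> ('h \<Rightarrow> 'a \<Rightarrow> 'k) \<Rightarrow> bool" where
  "bounded_klinear_into_L2 smul M T \<longleftrightarrow>
     (\<forall>v. square_integrable M (T v)) \<and>
     (\<forall>u v. AE \<alpha> in M. T (u + v) \<alpha> = T u \<alpha> + T v \<alpha>) \<and>
     (\<forall>c v. AE \<alpha> in M. T (smul c v) \<alpha> = c * T v \<alpha>) \<and>
     (\<exists>C. \<forall>v. L2_norm M (T v) \<le> C * norm v)"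

definition analysis_op :: "('h \<Rightarrow> 'h \<Rightarrow> 'k) \<Rightarrow> ('a \<Rightarrow> 'h) \<Rightarrow> 'h \<Rightarrow> 'a \<Rightarrow> 'k" where
  "analysis_op ip x h \<alpha> = ip h (x \<alpha>)"

definition frame_op ::
  "('k::rc_field \<Rightarrow> 'h \<Rightarrow> 'h) \<Rightarrow> ('h \<Rightarrow> 'h \<Rightarrow> 'k) \<Rightarrow> 'a measure \<Rightarrow> ('a \<Rightarrow> 'h) \<Rightarrow> ('a \<Rightarrow> 'h) \<Rightarrow> 'h \<Rightarrow> 'h"
  where
  "frame_op smul ip M x \<tau> h = weak_integral ip M (\<lambda>\<alpha>. smul (ip h (x \<alpha>)) (\<tau> \<alpha>))"

definition continuous_frame ::
  "('k::rc_field \<Rightarrow> 'h::banach \<Rightarrow> 'h) \<Rightarrow> ('h \<Rightarrow> 'h \<Rightarrow> 'k) \<Rightarrow> 'a measure \<Rightarrow>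
     ('a \<Rightarrow> 'h) \<Rightarrow> ('a \<Rightarrow> 'h) \<Rightarrow> bool" where
  "continuous_frame smul ip M x \<tau> \<longleftrightarrow>
     (\<forall>h. (\<lambda>\<alpha>. ip h (x \<alpha>)) \<in> borel_measurable M \<and> (\<lambda>\<alpha>. ip h (\<tau> \<alpha>)) \<in> borel_measurable M) \<and>
     (\<forall>h. \<exists>v. has_weak_integral ip M (\<lambda>\<alpha>. smul (ip h (x \<alpha>)) (\<tau> \<alpha>)) v) \<and>
     bounded_klinear smul (frame_op smul ip M x \<tau>) \<and>
     positive_op ip (frame_op smul ip M x \<tau>) \<and>
     invertible_op smul (frame_op smul ip M x \<tau>) \<and>
     bounded_klinear_into_L2 smul M (analysis_op ip x) \<and>
     bounded_klinear_into_L2 smul M (analysis_op ip \<tau>)"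

definition parseval_continuous_frame ::
  "('k::rc_field \<Rightarrow> 'h::banach \<Rightarrow> 'h) \<Rightarrow> ('h \<Rightarrow> 'h \<Rightarrow> 'k) \<Rightarrow> 'a measure \<Rightarrow>
     ('a \<Rightarrow> 'h) \<Rightarrow> ('a \<Rightarrow> 'h) \<Rightarrow> bool" where
  "parseval_continuous_frame smul ip M x \<tau> \<longleftrightarrow>
     continuous_frame smul ip M x \<tau> \<and> frame_op smul ip M x \<tau> = id"

text \<open>
  Topological groups are written additively, with neutral element \<open>0\<close>, following the class
  \<^class>\<open>topological_group_add\<close>, which does not assume commutativity. A left Haar measure is a
  nonzero left-invariant Radon measure on the Borel sets: finite on compact sets, outer regular on
  Borel sets and inner regular on open sets.
\<close>

definition left_haar_measure ::
  "'g::{topological_group_add, t2_space} measure \<Rightarrow> bool" where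
  "left_haar_measure M \<longleftrightarrow>
     sets M = sets borel \<and>
     emeasure M UNIV \<noteq> 0 \<and>
     (\<forall>K. compact K \<longrightarrow> emeasure M K < \<infinity>) \<and>
     (\<forall>A\<in>sets borel. emeasure M A = (INF U\<in>{U. open U \<and> A \<subseteq> U}. emeasure M U)) \<and>
     (\<forall>U. open U \<longrightarrow> emeasure M U = (SUP K\<in>{K. compact K \<and> K \<subseteq> U}. emeasure M K)) \<and>
     (\<forall>g. \<forall>A\<in>sets borel. emeasure M ((+) g ` A) = emeasure M A)"

definition unitary_representation ::
  "('k::rc_field \<Rightarrow> 'h::banach \<Rightarrow> 'h) \<Rightarrow> ('h \<Rightarrow> 'h \<Rightarrow> 'k) \<Rightarrow>
     ('g::topological_group_add \<Rightarrow> 'h \<Rightarrow> 'h) \<Rightarrow> bool" where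
  "unitary_representation smul ip \<pi> \<longleftrightarrow>
     (\<forall>g. unitary_op smul ip (\<pi> g)) \<and>
     (\<forall>g h. \<pi> (g + h) = \<pi> g \<circ> \<pi> h) \<and>
     (\<forall>v. continuous_on UNIV (\<lambda>g. \<pi> g v))"

end

theory Submission
  imports Defs
begin

text \<open>
  Given the Gram identities, \<open>\<pi>\<^sub>g h\<close> is characterised by \<open>\<langle>\<pi>\<^sub>g h, x\<^sub>p\<rangle> = \<langle>h, x\<^bsub>-g+p\<^esub>\<rangle>\<close> and
  \<open>\<langle>\<pi>\<^sub>g h, \<tau>\<^sub>p\<rangle> = \<langle>h, \<tau>\<^bsub>-g+p\<^esub>\<rangle>\<close> for all \<open>p\<close>. By the reconstruction formula and left invariance of the
  Haar measure, solutions preserve inner products, so the \<open>h\<close> that admit a solution form a closed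
  subspace; it contains every \<open>x\<^sub>p\<close> (with solution \<open>x\<^bsub>g+p\<^esub>\<close>), hence has trivial orthogonal complement
  and is the whole space. The analysis operator \<open>\<theta>\<^sub>x\<close> is bounded below and intertwines \<open>\<pi>\<close> with
  left translation on \<open>L\<^sup>2\<close>, so strong continuity of \<open>\<pi>\<close> follows from that of left translation, which
  is checked on indicators of compact sets by means of the regularity of the Haar measure.
\<close>

section \<open>Hilbert spaces\<close>

lemma kcnj_of_real: "kcnj (of_real a :: 'k::rc_field) = of_real a"
proof (cases "a = 0")
  case True
  then show ?thesis using kcnj_add[of "0::'k" 0] by simp
next
  case False
  have "of_real a * kcnj (of_real a :: 'k) = of_real a * of_real a"
    using mult_kcnj[of "of_real a :: 'k"] by (simp add: power2_eq_square flip: of_real_mult)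
  then show ?thesis using False by simp
qed

context hilbert_space
begin

lemma ip_zero_left [simp]: "ip 0 w = 0"
  using ip_add_left[of 0 0 w] by simp

lemma ip_minus_left: "ip (- u) w = - ip u w"
  using ip_add_left[of u "- u" w] by (simp add: eq_neg_iff_add_eq_0 add.commute)

lemma ip_diff_left: "ip (u - v) w = ip u w - ip v w"
  using ip_add_left[of u "- v" w] by (simp add: ip_minus_left)

lemma ip_add_right: "ip w (u + v) = ip w u + ip w v"
  by (metis ip_commute ip_add_left kcnj_add)

lemma ip_diff_right: "ip w (u - v) = ip w u - ip w v"
  using ip_add_right[of w "u - v" v] by (simp add: algebra_simps)

lemma ip_scaleR_left: "ip (r *\<^sub>R u) w = of_real r * ip u w"
  by (metis smul_of_real ip_smul_left)

lemma ip_smul_right: "ip w (smul c u) = kcnj c * ip w u"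
  by (metis ip_commute ip_smul_left kcnj_mult)

lemma ip_mult_ip_commute: "ip u v * ip v u = of_real ((norm (ip u v))\<^sup>2)"
  using mult_kcnj[of "ip u v"] ip_commute[of v u] by simp

text \<open>Taking norms in \<open>ip_mult_ip_commute\<close> allows a nonzero factor to be
  cancelled; the zero case uses that \<open>kcnj\<close> fixes 0.\<close>

lemma norm_ip_commute: "norm (ip u v) = norm (ip v u)"
proof -
  have "norm (ip u v) * norm (ip v u) = norm (ip u v) * norm (ip u v)"
    using arg_cong[OF ip_mult_ip_commute[of u v], of norm]
    by (simp add: norm_mult power2_eq_square)
  moreover have "ip v u = 0" if "ip u v = 0"
    using ip_commute[of v u] kcnj_of_real[of 0, where ?'k='k] that by simp
  ultimately show ?thesis by force
qed

lemma ip_self_eq_0: "ip v v = 0 \<longleftrightarrow> v = 0"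
  by (simp add: ip_self)

section \<open>Cauchy-Schwarz and the nearest-point argument\<close>

lemma parallelogram: "(norm (u + v))\<^sup>2 + (norm (u - v))\<^sup>2 = 2 * (norm u)\<^sup>2 + 2 * (norm v)\<^sup>2"
  for u v :: 'h
proof -
  have "ip (u + v) (u + v) + ip (u - v) (u - v) = 2 * ip u u + 2 * ip v v"
    by (simp add: ip_add_left ip_add_right ip_diff_left ip_diff_right)
  then have "(of_real ((norm (u + v))\<^sup>2 + (norm (u - v))\<^sup>2) :: 'k)
      = of_real (2 * (norm u)\<^sup>2 + 2 * (norm v)\<^sup>2)"
    by (simp add: ip_self)
  then show ?thesis by (simp only: of_real_eq_iff)
qed

text \<open>The coefficient carries the factor \<open>ip v u\<close> so that both cross terms become
  real and equal; what remains is a real quadratic in \<open>t\<close>, over either scalar field. It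
  serves Cauchy-Schwarz and the orthogonality of a nearest point.\<close>

lemma norm_diff_smul_ip:
  "(norm (v - smul (of_real t * ip v u) u))\<^sup>2 =
    (norm v)\<^sup>2 - 2 * t * (norm (ip v u))\<^sup>2 + t\<^sup>2 * (norm (ip v u))\<^sup>2 * (norm u)\<^sup>2"
    (is "?L = ?R")
proof -
  have *: "kcnj (ip v u) = ip u v" by (simp flip: ip_commute)
  have "of_real ?L = ip v v - 2 * of_real t * (ip v u * ip u v)
      + of_real t ^ 2 * (ip v u * ip u v) * ip u u"
    unfolding ip_self[symmetric]
    by (simp add: ip_diff_left ip_diff_right ip_smul_left ip_smul_right kcnj_mult kcnj_of_real *
        power2_eq_square algebra_simps)
  also have "\<dots> = of_real ?R"
    unfolding ip_mult_ip_commute ip_self by simp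
  finally show ?thesis by (simp only: of_real_eq_iff)
qed

lemma norm_ip_le: "norm (ip v u) \<le> norm v * norm u"
proof (cases "u = 0")
  case True
  then show ?thesis using ip_commute[of v 0] kcnj_of_real[of 0, where ?'k='k] by simp
next
  case False
  \<comment> \<open>This \<open>t\<close> minimises the quadratic of
    \<open>norm_diff_smul_ip\<close>: the subtracted multiple of \<open>u\<close> is the projection
    of \<open>v\<close> onto \<open>u\<close>.\<close>
  define t where "t = 1 / (norm u)\<^sup>2"
  have "0 \<le> (norm v)\<^sup>2 - 2 * t * (norm (ip v u))\<^sup>2 + t\<^sup>2 * (norm (ip v u))\<^sup>2 * (norm u)\<^sup>2"
    unfolding norm_diff_smul_ip[symmetric] by simp
  also have "\<dots> = (norm v)\<^sup>2 - (norm (ip v u))\<^sup>2 / (norm u)\<^sup>2"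
    using False by (simp add: t_def field_simps power2_eq_square)
  finally have "(norm (ip v u))\<^sup>2 \<le> (norm v * norm u)\<^sup>2"
    using False by (simp add: field_simps power2_eq_square)
  then show ?thesis by (rule power2_le_imp_le) simp
qed

lemma bounded_linear_ip_left: "bounded_linear (\<lambda>v. ip v u)"
  by (rule bounded_linear_intro[of _ "norm u"])
    (simp_all add: ip_add_left ip_scaleR_left scaleR_conv_of_real norm_ip_le)

lemma tendsto_ip_left: "(f \<longlongrightarrow> v) F \<Longrightarrow> ((\<lambda>n. ip (f n) u) \<longlongrightarrow> ip v u) F"
  by (rule bounded_linear.tendsto[OF bounded_linear_ip_left])

text \<open>A minimising sequence for the distance from \<open>h\<close> is Cauchy, its limit is a
  point of \<open>S\<close> nearest to \<open>h\<close>, the error is orthogonal to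
  \<open>S\<close>, and \<open>orth\<close> makes the error vanish.\<close>

lemma closed_subspace_eq_UNIV:
  assumes "closed S" "S \<noteq> {}"
    and add: "\<And>u v. u \<in> S \<Longrightarrow> v \<in> S \<Longrightarrow> u + v \<in> S"
    and smul: "\<And>c u. u \<in> S \<Longrightarrow> smul c u \<in> S"
    and orth: "\<And>v. (\<And>s. s \<in> S \<Longrightarrow> ip v s = 0) \<Longrightarrow> v = 0"
  shows "S = UNIV"
proof -
  have "h \<in> S" for h
  proof -
    define d where "d = infdist h S"
    have d0: "0 \<le> d" by (simp add: d_def infdist_nonneg)
    have d_le: "d \<le> norm (h - s)" if "s \<in> S" for s
      using infdist_le[OF that, of h] by (simp add: d_def dist_norm)
    have "\<exists>s\<in>S. (norm (h - s))\<^sup>2 < d\<^sup>2 + inverse (real (Suc n))" for n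
    proof -
      have "d < sqrt (d\<^sup>2 + inverse (real (Suc n)))"
        using d0 by (intro real_less_rsqrt) simp
      then obtain s where "s \<in> S" "norm (h - s) < sqrt (d\<^sup>2 + inverse (real (Suc n)))"
        using \<open>S \<noteq> {}\<close> cINF_less_iff[OF \<open>S \<noteq> {}\<close> bdd_below_image_dist]
        unfolding d_def infdist_notempty[OF \<open>S \<noteq> {}\<close>] dist_norm by blast
      then show ?thesis
        using power_strict_mono[of "norm (h - s)" "sqrt (d\<^sup>2 + inverse (real (Suc n)))" 2] by auto
    qed
    then obtain s where s: "\<And>n. s n \<in> S" "\<And>n. (norm (h - s n))\<^sup>2 < d\<^sup>2 + inverse (real (Suc n))"
      by metis
    have dist_s: "(norm (s m - s n))\<^sup>2 \<le> 2 * inverse (real (Suc m)) + 2 * inverse (real (Suc n))"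
      for m n
    proof -
      \<comment> \<open>Midpoints stay in \<open>S\<close>, so their distance from \<open>h\<close>
        is at least \<open>d\<close>; the parallelogram law then bounds the gap between two
        near-minimisers.\<close>
      have "(1/2) *\<^sub>R (s m + s n) \<in> S"
        using add[OF s(1) s(1)] smul[of _ "of_real (1/2)"] unfolding smul_of_real by blast
      then have "d \<le> norm (h - (1/2) *\<^sub>R (s m + s n))" by (rule d_le)
      then have "d\<^sup>2 \<le> (norm (h - (1/2) *\<^sub>R (s m + s n)))\<^sup>2"
        using d0 by (rule power_mono)
      moreover have "(h - s m) + (h - s n) = 2 *\<^sub>R (h - (1/2) *\<^sub>R (s m + s n))"
        by (simp add: algebra_simps scaleR_2)
      then have "(norm ((h - s m) + (h - s n)))\<^sup>2 = 4 * (norm (h - (1/2) *\<^sub>R (s m + s n)))\<^sup>2"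
        by (simp add: power_mult_distrib)
      moreover have "norm ((h - s m) - (h - s n)) = norm (s m - s n)"
        by (simp add: norm_minus_commute)
      ultimately show ?thesis
        using parallelogram[of "h - s m" "h - s n"] s(2)[of m] s(2)[of n] by simp
    qed
    have "Cauchy s"
    proof (rule metric_CauchyI)
      fix e :: real assume "0 < e"
      \<comment> \<open>Each of the two terms bounding \<open>dist_s\<close> is then below
        \<open>e\<^sup>2 / 2\<close>.\<close>
      then obtain N where N: "inverse (real (Suc N)) < e\<^sup>2 / 4"
        using reals_Archimedean[of "e\<^sup>2 / 4"] by auto
      have "dist (s m) (s n) < e" if "N \<le> m" "N \<le> n" for m n
      proof -
        have "inverse (real (Suc m)) \<le> inverse (real (Suc N))"
          "inverse (real (Suc n)) \<le> inverse (real (Suc N))"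
          using that by simp_all
        then have "(norm (s m - s n))\<^sup>2 < e\<^sup>2"
          using dist_s[of m n] N by linarith
        then show ?thesis
          using \<open>0 < e\<close> by (simp add: dist_norm power2_less_imp_less)
      qed
      then show "\<exists>M. \<forall>m\<ge>M. \<forall>n\<ge>M. dist (s m) (s n) < e" by blast
    qed
    then obtain l where l: "s \<longlonglongrightarrow> l"
      using Cauchy_convergent_iff convergent_def by blast
    have "l \<in> S" using closed_sequentially[OF \<open>closed S\<close>] s(1) l by blast
    have "(norm (h - l))\<^sup>2 \<le> d\<^sup>2"
    proof (rule LIMSEQ_le)
      show "(\<lambda>n. (norm (h - s n))\<^sup>2) \<longlonglongrightarrow> (norm (h - l))\<^sup>2"
        by (intro tendsto_intros l)
      show "(\<lambda>n. d\<^sup>2 + inverse (real (Suc n))) \<longlonglongrightarrow> d\<^sup>2"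
        using LIMSEQ_inverse_real_of_nat_add by blast
    qed (use s(2) less_imp_le in blast)
    have "ip (h - l) u = 0" if "u \<in> S" for u
    proof (rule ccontr)
      assume ne: "ip (h - l) u \<noteq> 0"
      define a where "a = (norm (ip (h - l) u))\<^sup>2"
      have "a > 0" using ne by (simp add: a_def)
      \<comment> \<open>The 1 in the denominator keeps \<open>t * (norm u)\<^sup>2\<close> strictly
        below 1. Moving from \<open>l\<close> along \<open>u\<close> then lowers the squared
        distance by \<open>2 * t * a\<close> and raises it by less than \<open>t * a\<close>, which
        contradicts minimality.\<close>
      define t where "t = 1 / (1 + (norm u)\<^sup>2)"
      have pos: "1 + (norm u)\<^sup>2 > 0" by (simp add: add_pos_nonneg)
      then have t: "t > 0" "t * (norm u)\<^sup>2 < 1" by (auto simp: t_def field_simps)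
      have "l + smul (of_real t * ip (h - l) u) u \<in> S"
        by (intro add smul \<open>l \<in> S\<close> that)
      then have "d\<^sup>2 \<le> (norm (h - (l + smul (of_real t * ip (h - l) u) u)))\<^sup>2"
        using d_le d0 power_mono by blast
      also have "\<dots> = (norm (h - l))\<^sup>2 - 2 * t * a + t\<^sup>2 * a * (norm u)\<^sup>2"
        unfolding a_def norm_diff_smul_ip[symmetric] by (simp add: algebra_simps)
      also have "t\<^sup>2 * a * (norm u)\<^sup>2 = (t * a) * (t * (norm u)\<^sup>2)"
        by (simp add: power2_eq_square)
      also have "\<dots> < (t * a) * 1"
        using t \<open>a > 0\<close> by (intro mult_strict_left_mono) auto
      finally have "t * a < 0"
        using \<open>(norm (h - l))\<^sup>2 \<le> d\<^sup>2\<close> by linarith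
      then show False using t \<open>a > 0\<close> by (simp add: mult_less_0_iff)
    qed
    then have "h - l = 0" by (rule orth)
    then show "h \<in> S" using \<open>l \<in> S\<close> by simp
  qed
  then show ?thesis by auto
qed

end

section \<open>Continuity of translation in \<open>L\<^sup>2\<close> of a Haar measure\<close>

locale left_haar =
  fixes \<mu> :: "'g::{topological_group_add, t2_space} measure"
  assumes haar: "left_haar_measure \<mu>"
begin

section \<open>Invariance and regularity of the Haar measure\<close>

lemma sets_eq [measurable_cong]: "sets \<mu> = sets borel"
  using haar by (simp add: left_haar_measure_def)

lemma space_eq [simp]: "space \<mu> = UNIV"
  using sets_eq_imp_space_eq[OF sets_eq] by simp

lemma measurable_translation [measurable]: "(+) g \<in> measurable \<mu> \<mu>"
  unfolding measurable_cong_sets[OF sets_eq sets_eq]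
  by (rule borel_measurable_continuous_onI) (intro continuous_intros)

lemma emeasure_compact: "compact K \<Longrightarrow> emeasure \<mu> K < \<infinity>"
  using haar unfolding left_haar_measure_def by blast

lemma outer_regular:
  "A \<in> sets borel \<Longrightarrow> emeasure \<mu> A = (INF U\<in>{U. open U \<and> A \<subseteq> U}. emeasure \<mu> U)"
  using haar unfolding left_haar_measure_def by blast

lemma inner_regular:
  "open U \<Longrightarrow> emeasure \<mu> U = (SUP K\<in>{K. compact K \<and> K \<subseteq> U}. emeasure \<mu> K)"
  using haar unfolding left_haar_measure_def by blast

text \<open>Haar invariance is stated for images, whereas measurability and push-forwards speak of
  preimages; this passes from one to the other.\<close>

lemma vimage_translation: "(+) g -` A = (+) (- g) ` A" for A :: "'g set"
  by (force simp: image_iff simp flip: add.assoc)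

lemma emeasure_translation: "A \<in> sets borel \<Longrightarrow> emeasure \<mu> ((+) g ` A) = emeasure \<mu> A"
  using haar unfolding left_haar_measure_def by blast

lemma distr_translation: "distr \<mu> \<mu> ((+) g) = \<mu>"
proof (rule measure_eqI)
  fix A assume "A \<in> sets (distr \<mu> \<mu> ((+) g))"
  then show "emeasure (distr \<mu> \<mu> ((+) g)) A = emeasure \<mu> A"
    by (simp add: emeasure_distr vimage_translation emeasure_translation sets_eq)
qed simp

lemma integral_translation:
  fixes f :: "'g \<Rightarrow> 'b::{banach, second_countable_topology}"
  assumes "f \<in> borel_measurable \<mu>"
  shows "(\<integral>\<alpha>. f (g + \<alpha>) \<partial>\<mu>) = (\<integral>\<alpha>. f \<alpha> \<partial>\<mu>)"
  using integral_distr[OF measurable_translation[of g] assms] by (simp add: distr_translation)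

lemma integrable_translation:
  fixes f :: "'g \<Rightarrow> 'b::{banach, second_countable_topology}"
  assumes "integrable \<mu> f"
  shows "integrable \<mu> (\<lambda>\<alpha>. f (g + \<alpha>))"
  using integrable_distr[OF measurable_translation[of g], of f] assms
  by (simp add: distr_translation)

text \<open>The tube lemma, applied to the slice \<open>{0} \<times> K\<close> inside the open
  preimage of \<open>U\<close> under addition.\<close>

lemma eventually_translate_compact_subset:
  fixes K U :: "'g set"
  assumes "compact K" "open U" "K \<subseteq> U"
  shows "\<forall>\<^sub>F g in nhds 0. \<forall>k\<in>K. g + k \<in> U"
proof -
  define W where "W = (\<lambda>p :: 'g \<times> 'g. fst p + snd p) -` U"
  have "open W"
    unfolding W_def using \<open>open U\<close> by (intro open_vimage continuous_intros)
  moreover have "{0} \<times> K \<subseteq> W" using \<open>K \<subseteq> U\<close> by (auto simp: W_def)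
  ultimately have "\<exists>X. 0 \<in> X \<and> open X \<and> X \<times> K \<subseteq> W"
    by (rule Elementary_Topology.tube_lemma[OF \<open>compact K\<close>])
  then obtain X where "0 \<in> X" "open X" "X \<times> K \<subseteq> W"
    by (elim exE conjE)
  then show ?thesis
    unfolding eventually_nhds by (intro exI[of _ X]) (auto simp: W_def)
qed

end

section \<open>Square-integrable functions\<close>

lemma norm_add_sq_le: "(norm (a + b))\<^sup>2 \<le> 2 * (norm a)\<^sup>2 + 2 * (norm b)\<^sup>2"
  for a b :: "'b::real_normed_vector"
proof -
  have "(norm (a + b))\<^sup>2 \<le> (norm a + norm b)\<^sup>2"
    by (intro power_mono norm_triangle_ineq) simp
  also have "\<dots> \<le> 2 * (norm a)\<^sup>2 + 2 * (norm b)\<^sup>2"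
    using sum_squares_bound[of "norm a" "norm b"] by (simp add: power2_sum)
  finally show ?thesis .
qed

lemma square_integrable_add:
  assumes "square_integrable M f" "square_integrable M h"
  shows "square_integrable M (\<lambda>a. f a + h a)"
proof -
  have [measurable]: "f \<in> borel_measurable M" "h \<in> borel_measurable M"
    using assms by (auto simp: square_integrable_def)
  have "integrable M (\<lambda>a. (norm (f a + h a))\<^sup>2)"
  proof (rule Bochner_Integration.integrable_bound)
    show "integrable M (\<lambda>a. 2 * (norm (f a))\<^sup>2 + 2 * (norm (h a))\<^sup>2)"
      using assms by (auto simp: square_integrable_def)
  qed (auto simp: norm_add_sq_le)
  then show ?thesis by (simp add: square_integrable_def)
qed

lemma square_integrable_uminus:
  "square_integrable M f \<Longrightarrow> square_integrable M (\<lambda>a. - f a)"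
  by (simp add: square_integrable_def)

lemma square_integrable_diff:
  "square_integrable M f \<Longrightarrow> square_integrable M h \<Longrightarrow> square_integrable M (\<lambda>a. f a - h a)"
  using square_integrable_add[OF _ square_integrable_uminus, of M f h] by simp

lemma square_integrable_sum:
  "(\<And>i. i \<in> I \<Longrightarrow> square_integrable M (f i)) \<Longrightarrow> square_integrable M (\<lambda>a. \<Sum>i\<in>I. f i a)"
  by (induction I rule: infinite_finite_induct)
    (auto intro!: square_integrable_add simp: square_integrable_def[of _ "\<lambda>a. 0"])

lemma square_integrable_indicator:
  assumes "A \<in> sets M" "emeasure M A < \<infinity>"
  shows "square_integrable M (\<lambda>a. indicator A a *\<^sub>R c)"
proof -
  have "(norm (indicator A a *\<^sub>R c))\<^sup>2 = indicator A a * (norm c)\<^sup>2" for a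
    by (auto split: split_indicator)
  then show ?thesis using assms
    by (auto simp: square_integrable_def)
qed

text \<open>At the price of the factor 2 this replaces Minkowski's inequality, and all later
  estimates stay in terms of squared norms.\<close>

lemma integral_norm_add_sq_le:
  assumes "square_integrable M f" "square_integrable M h"
  shows "(\<integral>a. (norm (f a + h a))\<^sup>2 \<partial>M) \<le> 2 * (\<integral>a. (norm (f a))\<^sup>2 \<partial>M) + 2 * (\<integral>a. (norm (h a))\<^sup>2 \<partial>M)"
proof -
  have "(\<integral>a. (norm (f a + h a))\<^sup>2 \<partial>M) \<le> (\<integral>a. 2 * (norm (f a))\<^sup>2 + 2 * (norm (h a))\<^sup>2 \<partial>M)"
    using assms square_integrable_add[OF assms]
    by (intro integral_mono norm_add_sq_le) (auto simp: square_integrable_def)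
  then show ?thesis using assms by (simp add: square_integrable_def)
qed

context left_haar
begin

section \<open>Closure properties of translation continuity\<close>

lemma square_integrable_translation:
  "square_integrable \<mu> f \<Longrightarrow> square_integrable \<mu> (\<lambda>\<alpha>. f (g + \<alpha>))"
  unfolding square_integrable_def
  using integrable_translation[of "\<lambda>\<alpha>. (norm (f \<alpha>))\<^sup>2" g] measurable_compose[OF measurable_translation]
  by blast

text \<open>Continuity at the neutral element of the orbit of \<open>f\<close> under the left
  regular representation, measured by the squared L2 distance. A Bochner integral that does not
  exist is 0 by default, so the rules for sums and for approximation also assume square
  integrability.\<close>

definition translation_continuous :: "('g \<Rightarrow> 'k::rc_field) \<Rightarrow> bool" where
  "translation_continuous f \<longleftrightarrow>
     ((\<lambda>g. \<integral>\<alpha>. (norm (f (- g + \<alpha>) - f \<alpha>))\<^sup>2 \<partial>\<mu>) \<longlongrightarrow> 0) (nhds 0)"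

lemma translation_continuousI:
  assumes "\<And>e. e > 0 \<Longrightarrow> \<forall>\<^sub>F g in nhds 0. (\<integral>\<alpha>. (norm (f (- g + \<alpha>) - f \<alpha>))\<^sup>2 \<partial>\<mu>) < e"
  shows "translation_continuous f"
  unfolding translation_continuous_def using assms
  by (intro order_tendstoI) (auto intro!: always_eventually intro: less_le_trans integral_nonneg_AE)

lemma translation_continuous_add:
  assumes "square_integrable \<mu> f" "square_integrable \<mu> h"
    and "translation_continuous f" "translation_continuous h"
  shows "translation_continuous (\<lambda>\<alpha>. f \<alpha> + h \<alpha>)"
  unfolding translation_continuous_def
proof (rule Lim_null_comparison)
  let ?D = "\<lambda>f g. \<integral>\<alpha>. (norm (f (- g + \<alpha>) - f \<alpha>))\<^sup>2 \<partial>\<mu>"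
  show "((\<lambda>g. 2 * ?D f g + 2 * ?D h g) \<longlongrightarrow> 0) (nhds 0)"
    using assms(3,4) unfolding translation_continuous_def
    by (auto intro!: tendsto_eq_intros)
  have "?D (\<lambda>\<alpha>. f \<alpha> + h \<alpha>) g \<le> 2 * ?D f g + 2 * ?D h g" for g
    using integral_norm_add_sq_le[of \<mu> "\<lambda>\<alpha>. f (- g + \<alpha>) - f \<alpha>" "\<lambda>\<alpha>. h (- g + \<alpha>) - h \<alpha>"] assms
    by (simp add: square_integrable_diff square_integrable_translation algebra_simps)
  then show "\<forall>\<^sub>F g in nhds 0. norm (?D (\<lambda>\<alpha>. f \<alpha> + h \<alpha>) g) \<le> 2 * ?D f g + 2 * ?D h g"
    by simp
qed

lemma translation_continuous_sum:
  assumes "\<And>i. i \<in> I \<Longrightarrow> square_integrable \<mu> (f i)" "\<And>i. i \<in> I \<Longrightarrow> translation_continuous (f i)"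
  shows "translation_continuous (\<lambda>\<alpha>. \<Sum>i\<in>I. f i \<alpha>)"
  using assms
  by (induction I rule: infinite_finite_induct)
    (auto intro!: translation_continuous_add square_integrable_sum
      simp: translation_continuous_def[of "\<lambda>\<alpha>. 0"])

text \<open>Closedness under L2 limits: by left invariance the error \<open>f - s\<close> and its
  translate have equal L2 norm, so the estimate is uniform in \<open>g\<close> and only the motion
  of \<open>s\<close> has to be controlled.\<close>

lemma translation_continuous_approx:
  assumes f: "square_integrable \<mu> f"
    and approx: "\<And>e. e > 0 \<Longrightarrow> \<exists>s. square_integrable \<mu> s \<and> translation_continuous s \<and>
      (\<integral>\<alpha>. (norm (f \<alpha> - s \<alpha>))\<^sup>2 \<partial>\<mu>) < e"
  shows "translation_continuous f"
proof (rule translation_continuousI)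
  fix e :: real assume "e > 0"
  \<comment> \<open>The error integral enters with the factor 2 * (2 + 2) = 8 and so costs
    \<open>e / 2\<close>; the other half is left for twice the motion of \<open>s\<close>, which is
    kept below \<open>e / 4\<close>.\<close>
  then obtain s where s: "square_integrable \<mu> s" "translation_continuous s"
      "(\<integral>\<alpha>. (norm (f \<alpha> - s \<alpha>))\<^sup>2 \<partial>\<mu>) < e / 16"
    using approx[of "e / 16"] by auto
  have fs: "square_integrable \<mu> (\<lambda>\<alpha>. f \<alpha> - s \<alpha>)"
    by (intro square_integrable_diff f s)
  let ?D = "\<lambda>f g. \<integral>\<alpha>. (norm (f (- g + \<alpha>) - f \<alpha>))\<^sup>2 \<partial>\<mu>"
  have *: "?D f g < e" if "?D s g < e / 4" for g
  proof -
    have sq: "square_integrable \<mu> (\<lambda>\<alpha>. s (- g + \<alpha>) - s \<alpha>)"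
        "square_integrable \<mu> (\<lambda>\<alpha>. (f (- g + \<alpha>) - s (- g + \<alpha>)) - (f \<alpha> - s \<alpha>))"
      by (intro square_integrable_diff square_integrable_translation f s)+
    have "?D f g \<le> 2 * ?D s g + 2 * ?D (\<lambda>\<alpha>. f \<alpha> - s \<alpha>) g"
      using integral_norm_add_sq_le[OF sq] by simp
    moreover have "?D (\<lambda>\<alpha>. f \<alpha> - s \<alpha>) g \<le>
        2 * (\<integral>\<alpha>. (norm (f (- g + \<alpha>) - s (- g + \<alpha>)))\<^sup>2 \<partial>\<mu>) + 2 * (\<integral>\<alpha>. (norm (f \<alpha> - s \<alpha>))\<^sup>2 \<partial>\<mu>)"
      using integral_norm_add_sq_le[OF square_integrable_translation[OF fs]
          square_integrable_uminus[OF fs], of "- g"]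
      by (simp only: diff_conv_add_uminus norm_minus_cancel)
    moreover have "(\<integral>\<alpha>. (norm (f (- g + \<alpha>) - s (- g + \<alpha>)))\<^sup>2 \<partial>\<mu>) = (\<integral>\<alpha>. (norm (f \<alpha> - s \<alpha>))\<^sup>2 \<partial>\<mu>)"
      by (rule integral_translation) (use fs in \<open>auto simp: square_integrable_def\<close>)
    ultimately show ?thesis using that s(3) by linarith
  qed
  have "\<forall>\<^sub>F g in nhds 0. ?D s g < e / 4"
    using s(2) \<open>e > 0\<close> unfolding translation_continuous_def
    by (intro order_tendstoD(2)) auto
  then show "\<forall>\<^sub>F g in nhds 0. ?D f g < e"
    by (rule eventually_mono) (rule *)
qed

section \<open>From compact sets to square-integrable functions by regularity\<close>

lemma obtain_open_superset:
  assumes "A \<in> sets borel" "emeasure \<mu> A < \<infinity>" "e > 0"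
  obtains U where "open U" "A \<subseteq> U" "emeasure \<mu> U < \<infinity>" "measure \<mu> U < measure \<mu> A + e"
proof -
  have "(INF U\<in>{U. open U \<and> A \<subseteq> U}. emeasure \<mu> U) = emeasure \<mu> A"
    using outer_regular[OF assms(1)] by simp
  also have "\<dots> < ennreal (measure \<mu> A + e)"
    using assms by (simp add: emeasure_eq_ennreal_measure ennreal_less_iff del: ennreal_plus)
  finally obtain U where U: "open U" "A \<subseteq> U" "emeasure \<mu> U < ennreal (measure \<mu> A + e)"
    by (auto simp: INF_less_iff)
  \<comment> \<open>Finiteness comes first because \<open>measure\<close> is 0 on sets of infinite
    measure.\<close>
  have fin: "emeasure \<mu> U < \<infinity>"
    using less_trans[OF U(3) ennreal_less_top] by simp
  then have "measure \<mu> U < measure \<mu> A + e"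
    using U(3) \<open>e > 0\<close> by (simp add: emeasure_eq_ennreal_measure ennreal_less_iff del: ennreal_plus)
  with U fin show thesis by (rule_tac that)
qed

lemma obtain_compact_subset:
  assumes "open U" "emeasure \<mu> U < \<infinity>" "e > 0"
  obtains K where "compact K" "K \<subseteq> U" "measure \<mu> U - e < measure \<mu> K"
proof (cases "measure \<mu> U - e < 0")
  \<comment> \<open>Since \<open>ennreal\<close> sends negative numbers to 0, the strict comparison
    in \<open>ennreal\<close> could fail here; the empty set serves instead.\<close>
  case True
  then show thesis using that[of "{}"] by simp
next
  case False
  have "ennreal (measure \<mu> U - e) < emeasure \<mu> U"
    using assms False by (simp add: emeasure_eq_ennreal_measure ennreal_less_iff del: ennreal_plus)
  also have "\<dots> = (SUP K\<in>{K. compact K \<and> K \<subseteq> U}. emeasure \<mu> K)"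
    using assms(1) by (rule inner_regular)
  finally obtain K where K: "compact K" "K \<subseteq> U" "ennreal (measure \<mu> U - e) < emeasure \<mu> K"
    by (auto simp: less_SUP_iff)
  have "emeasure \<mu> K < \<infinity>"
    using \<open>compact K\<close> by (rule emeasure_compact)
  then have "measure \<mu> U - e < measure \<mu> K"
    using K(3) False by (simp add: emeasure_eq_ennreal_measure ennreal_less_iff del: ennreal_plus)
  with K show thesis by (rule_tac that)
qed

text \<open>Two sets that both nearly fill a common superset \<open>U\<close> are close in L2: a
  point lying in exactly one of them is missed by the other inside \<open>U\<close>.\<close>

lemma integral_norm_indicator_diff_le:
  fixes c :: "'k::rc_field"
  assumes [measurable]: "A \<in> sets \<mu>" "B \<in> sets \<mu>" "U \<in> sets \<mu>"
    and "A \<subseteq> U" "B \<subseteq> U" "emeasure \<mu> U < \<infinity>"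
  shows "(\<integral>\<alpha>. (norm (indicator A \<alpha> *\<^sub>R c - indicator B \<alpha> *\<^sub>R c))\<^sup>2 \<partial>\<mu>)
    \<le> (norm c)\<^sup>2 * ((measure \<mu> U - measure \<mu> A) + (measure \<mu> U - measure \<mu> B))"
proof -
  have fin: "emeasure \<mu> A < \<infinity>" "emeasure \<mu> B < \<infinity>"
    using assms by (meson emeasure_mono le_less_trans)+
  then have int: "integrable \<mu> (indicator A :: _ \<Rightarrow> real)" "integrable \<mu> (indicator B :: _ \<Rightarrow> real)"
      "integrable \<mu> (indicator U :: _ \<Rightarrow> real)"
    using assms by auto
  have "(\<integral>\<alpha>. (norm (indicator A \<alpha> *\<^sub>R c - indicator B \<alpha> *\<^sub>R c))\<^sup>2 \<partial>\<mu>) \<le>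
      (\<integral>\<alpha>. (norm c)\<^sup>2 * ((indicator U \<alpha> - indicator A \<alpha>) + (indicator U \<alpha> - indicator B \<alpha>)) \<partial>\<mu>)"
  proof (rule integral_mono)
    show "integrable \<mu> (\<lambda>\<alpha>. (norm (indicator A \<alpha> *\<^sub>R c - indicator B \<alpha> *\<^sub>R c))\<^sup>2)"
      using square_integrable_diff[OF square_integrable_indicator square_integrable_indicator,
          of A \<mu> B c c] fin
      by (simp add: square_integrable_def)
    show "integrable \<mu> (\<lambda>\<alpha>. (norm c)\<^sup>2 * ((indicator U \<alpha> - indicator A \<alpha>) + (indicator U \<alpha> - indicator B \<alpha>)))"
      using int by simp
  qed (use \<open>A \<subseteq> U\<close> \<open>B \<subseteq> U\<close> in \<open>auto simp: indicator_def\<close>)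
  also have "\<dots> = (norm c)\<^sup>2 * ((measure \<mu> U - measure \<mu> A) + (measure \<mu> U - measure \<mu> B))"
    using int by simp
  finally show ?thesis .
qed

text \<open>Outer regularity gives an open \<open>U\<close> barely larger than \<open>K\<close>.
  Small translates of \<open>K\<close> stay inside \<open>U\<close> and have the measure of
  \<open>K\<close>, so both sets nearly fill \<open>U\<close>.\<close>

lemma translation_continuous_indicator_compact:
  fixes c :: "'k::rc_field"
  assumes "compact K"
  shows "translation_continuous (\<lambda>\<alpha>. indicator K \<alpha> *\<^sub>R c)"
proof (rule translation_continuousI)
  fix e :: real assume "e > 0"
  \<comment> \<open>Both deficits in \<open>U\<close> are at most \<open>d\<close>, hence the factor
    2; the added 1 covers \<open>c = 0\<close>.\<close>
  define d where "d = e / (2 * (norm c)\<^sup>2 + 1)"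
  have pos: "2 * (norm c)\<^sup>2 + 1 > 0" by (simp add: add_nonneg_pos)
  then have "d > 0" using \<open>e > 0\<close> by (simp add: d_def)
  have d: "2 * (norm c)\<^sup>2 * d < e"
    using \<open>e > 0\<close> pos by (simp add: d_def field_simps)
  have K: "K \<in> sets borel" "emeasure \<mu> K < \<infinity>"
    using \<open>compact K\<close> compact_imp_closed borel_closed emeasure_compact by blast+
  obtain U where U: "open U" "K \<subseteq> U" "emeasure \<mu> U < \<infinity>" "measure \<mu> U < measure \<mu> K + d"
    using obtain_open_superset[OF K \<open>d > 0\<close>] .
  have "(\<integral>\<alpha>. (norm (indicator K (- g + \<alpha>) *\<^sub>R c - indicator K \<alpha> *\<^sub>R c))\<^sup>2 \<partial>\<mu>) < e"
    if g: "\<forall>k\<in>K. g + k \<in> U" for g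
  proof -
    \<comment> \<open>\<open>B\<close> is the translate of \<open>K\<close> by \<open>g\<close>, and
      its indicator is the translated indicator of \<open>K\<close>.\<close>
    define B where "B = (+) (- g) -` K"
    have B: "B \<in> sets \<mu>" "measure \<mu> B = measure \<mu> K"
      using measurable_sets[OF measurable_translation[of "- g"], of K] K
        emeasure_translation[of K g]
      by (auto simp: B_def sets_eq vimage_translation measure_def)
    have "B \<subseteq> U"
    proof
      fix b assume "b \<in> B"
      then have "g + (- g + b) \<in> U" using g by (simp add: B_def del: add_minus_cancel)
      then show "b \<in> U" by simp
    qed
    have "(\<integral>\<alpha>. (norm (indicator B \<alpha> *\<^sub>R c - indicator K \<alpha> *\<^sub>R c))\<^sup>2 \<partial>\<mu>)
      \<le> (norm c)\<^sup>2 * ((measure \<mu> U - measure \<mu> B) + (measure \<mu> U - measure \<mu> K))"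
      using B K U \<open>B \<subseteq> U\<close> by (intro integral_norm_indicator_diff_le) (auto simp: sets_eq)
    also have "\<dots> \<le> (norm c)\<^sup>2 * (2 * d)"
      using U(4) B(2) by (intro mult_left_mono) auto
    finally show ?thesis
      using d by (simp add: B_def indicator_def)
  qed
  then show "\<forall>\<^sub>F g in nhds 0. (\<integral>\<alpha>. (norm (indicator K (- g + \<alpha>) *\<^sub>R c - indicator K \<alpha> *\<^sub>R c))\<^sup>2 \<partial>\<mu>) < e"
    using eventually_translate_compact_subset[OF \<open>compact K\<close> U(1,2)]
    by (rule eventually_mono[rotated])
qed

text \<open>Inner regularity is available for open sets, so the compact \<open>K\<close> is chosen
  inside an open \<open>U\<close> around \<open>A\<close> and need not lie in \<open>A\<close>; it
  suffices that both nearly fill \<open>U\<close>.\<close>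

lemma translation_continuous_indicator:
  fixes c :: "'k::rc_field"
  assumes A: "A \<in> sets \<mu>" "emeasure \<mu> A < \<infinity>"
  shows "translation_continuous (\<lambda>\<alpha>. indicator A \<alpha> *\<^sub>R c)"
proof (rule translation_continuous_approx)
  show "square_integrable \<mu> (\<lambda>\<alpha>. indicator A \<alpha> *\<^sub>R c)"
    using A by (rule square_integrable_indicator)
  fix e :: real assume "e > 0"
  define d where "d = e / (2 * (norm c)\<^sup>2 + 1)"
  have pos: "2 * (norm c)\<^sup>2 + 1 > 0" by (simp add: add_nonneg_pos)
  then have "d > 0" using \<open>e > 0\<close> by (simp add: d_def)
  have d: "2 * (norm c)\<^sup>2 * d < e"
    using \<open>e > 0\<close> pos by (simp add: d_def field_simps)
  obtain U where U: "open U" "A \<subseteq> U" "emeasure \<mu> U < \<infinity>" "measure \<mu> U < measure \<mu> A + d"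
    using obtain_open_superset[OF A(1)[unfolded sets_eq] A(2) \<open>d > 0\<close>] .
  obtain K where K: "compact K" "K \<subseteq> U" "measure \<mu> U - d < measure \<mu> K"
    using obtain_compact_subset[OF U(1,3) \<open>d > 0\<close>] .
  have K': "K \<in> sets borel" "emeasure \<mu> K < \<infinity>"
    using \<open>compact K\<close> compact_imp_closed borel_closed emeasure_compact by blast+
  have "(\<integral>\<alpha>. (norm (indicator A \<alpha> *\<^sub>R c - indicator K \<alpha> *\<^sub>R c))\<^sup>2 \<partial>\<mu>)
      \<le> (norm c)\<^sup>2 * ((measure \<mu> U - measure \<mu> A) + (measure \<mu> U - measure \<mu> K))"
    using A K K' U by (intro integral_norm_indicator_diff_le) (auto simp: sets_eq)
  also have "\<dots> \<le> (norm c)\<^sup>2 * (2 * d)"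
    using U(4) K(3) by (intro mult_left_mono) auto
  finally have "(\<integral>\<alpha>. (norm (indicator A \<alpha> *\<^sub>R c - indicator K \<alpha> *\<^sub>R c))\<^sup>2 \<partial>\<mu>) < e"
    using d by simp
  then show "\<exists>s. square_integrable \<mu> s \<and> translation_continuous s \<and>
      (\<integral>\<alpha>. (norm (indicator A \<alpha> *\<^sub>R c - s \<alpha>))\<^sup>2 \<partial>\<mu>) < e"
    using translation_continuous_indicator_compact[OF K(1), of c]
      square_integrable_indicator[of K \<mu> c] K' by (auto simp: sets_eq)
qed

text \<open>The function is a finite sum over its level sets. The value 0 is left out because its
  level set may have infinite measure.\<close>

lemma translation_continuous_simple:
  fixes s :: "'g \<Rightarrow> 'k::rc_field"
  assumes s: "simple_function \<mu> s" "square_integrable \<mu> s"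
  shows "translation_continuous s"
proof -
  have fin: "finite (range s)"
    using simple_functionD(1)[OF s(1)] by simp
  have meas: "s -` {y} \<in> sets \<mu>" for y
    using simple_functionD(2)[OF s(1), of "{y}"] by simp
  have "emeasure \<mu> (s -` {y}) < \<infinity>" if "y \<noteq> 0" for y
  proof -
    \<comment> \<open>Chebyshev's argument: the indicator of the level set is dominated by a
      multiple of the squared norm of \<open>s\<close>.\<close>
    have "integrable \<mu> (indicator (s -` {y}) :: 'g \<Rightarrow> real)"
    proof (rule Bochner_Integration.integrable_bound)
      show "integrable \<mu> (\<lambda>\<alpha>. (norm (s \<alpha>))\<^sup>2 / (norm y)\<^sup>2)"
        using s(2) by (simp add: square_integrable_def)
    qed (use meas that in \<open>auto simp: indicator_def\<close>)
    then show ?thesis by (simp add: integrable_indicator_iff)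
  qed
  then have "translation_continuous (\<lambda>\<alpha>. \<Sum>y\<in>range s - {0}. indicator (s -` {y}) \<alpha> *\<^sub>R y)"
    by (intro translation_continuous_sum translation_continuous_indicator
        square_integrable_indicator meas) auto
  moreover have "(\<Sum>y\<in>range s - {0}. indicator (s -` {y}) \<alpha> *\<^sub>R y) = s \<alpha>" for \<alpha>
  proof -
    have "(\<Sum>y\<in>range s - {0}. indicator (s -` {y}) \<alpha> *\<^sub>R y)
        = (\<Sum>y\<in>range s - {0}. if y = s \<alpha> then y else 0)"
      by (intro sum.cong) (auto simp: indicator_def)
    then show ?thesis using fin by simp
  qed
  ultimately show ?thesis by simp
qed

theorem translation_continuous_square_integrable:
  fixes f :: "'g \<Rightarrow> 'k::rc_field"
  assumes f: "square_integrable \<mu> f"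
  shows "translation_continuous f"
proof (rule translation_continuous_approx[OF f])
  fix e :: real assume "e > 0"
  have [measurable]: "f \<in> borel_measurable \<mu>"
    using f by (simp add: square_integrable_def)
  \<comment> \<open>Centring the approximation at the point 0 yields the domination by
    \<open>2 * norm (f \<alpha>)\<close>.\<close>
  obtain F where F: "\<And>i. simple_function \<mu> (F i)" "\<And>\<alpha>. (\<lambda>i. F i \<alpha>) \<longlonglongrightarrow> f \<alpha>"
      "\<And>i \<alpha>. norm (F i \<alpha>) \<le> 2 * norm (f \<alpha>)"
    using borel_measurable_implies_sequence_metric[of f \<mu> 0] by auto
  have [measurable]: "F i \<in> borel_measurable \<mu>" for i
    using F(1) by (rule borel_measurable_simple_function)
  \<comment> \<open>The constant is 2 * 1 + 2 * 4, from \<open>norm_add_sq_le\<close> and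
    \<open>F_le\<close>.\<close>
  have dom: "integrable \<mu> (\<lambda>\<alpha>. 10 * (norm (f \<alpha>))\<^sup>2)"
    using f by (simp add: square_integrable_def)
  have F_le: "(norm (F i \<alpha>))\<^sup>2 \<le> 4 * (norm (f \<alpha>))\<^sup>2" for i \<alpha>
    using power_mono[OF F(3)[of i \<alpha>], of 2] by (simp add: power_mult_distrib)
  have sq: "square_integrable \<mu> (F i)" for i
    unfolding square_integrable_def
  proof
    show "integrable \<mu> (\<lambda>\<alpha>. (norm (F i \<alpha>))\<^sup>2)"
      by (rule Bochner_Integration.integrable_bound[OF dom])
        (auto intro!: AE_I2 order_trans[OF F_le])
  qed simp
  have "(\<lambda>i. \<integral>\<alpha>. (norm (f \<alpha> - F i \<alpha>))\<^sup>2 \<partial>\<mu>) \<longlonglongrightarrow> (\<integral>\<alpha>. 0 \<partial>\<mu>)"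
  proof (rule integral_dominated_convergence[OF _ _ dom])
    have "(\<lambda>i. (norm (f \<alpha> - F i \<alpha>))\<^sup>2) \<longlonglongrightarrow> (norm (f \<alpha> - f \<alpha>))\<^sup>2" for \<alpha>
      by (intro tendsto_intros F(2))
    then show "AE \<alpha> in \<mu>. (\<lambda>i. (norm (f \<alpha> - F i \<alpha>))\<^sup>2) \<longlonglongrightarrow> 0" by simp
    have "(norm (f \<alpha> - F i \<alpha>))\<^sup>2 \<le> 10 * (norm (f \<alpha>))\<^sup>2" for i \<alpha>
      using norm_add_sq_le[of "f \<alpha>" "- F i \<alpha>"] F_le[of i \<alpha>] by simp
    then show "AE \<alpha> in \<mu>. norm ((norm (f \<alpha> - F i \<alpha>))\<^sup>2) \<le> 10 * (norm (f \<alpha>))\<^sup>2" for i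
      by simp
  qed simp_all
  then have "\<forall>\<^sub>F i in sequentially. (\<integral>\<alpha>. (norm (f \<alpha> - F i \<alpha>))\<^sup>2 \<partial>\<mu>) < e"
    using \<open>e > 0\<close> by (intro order_tendstoD(2)) auto
  then obtain i where "(\<integral>\<alpha>. (norm (f \<alpha> - F i \<alpha>))\<^sup>2 \<partial>\<mu>) < e"
    using eventually_happens'[OF sequentially_bot] by blast
  then show "\<exists>s. square_integrable \<mu> s \<and> translation_continuous s \<and>
      (\<integral>\<alpha>. (norm (f \<alpha> - s \<alpha>))\<^sup>2 \<partial>\<mu>) < e"
    using sq translation_continuous_simple[OF F(1) sq] by blast
qed

end

section \<open>Parseval frames indexed by a group\<close>

locale parseval_frame = hilbert_space smul ip + left_haar \<mu>
  for smul :: "'k::rc_field \<Rightarrow> 'h::banach \<Rightarrow> 'h"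
    and ip :: "'h \<Rightarrow> 'h \<Rightarrow> 'k"
    and \<mu> :: "'g::{topological_group_add, t2_space} measure" +
  fixes x \<tau> :: "'g \<Rightarrow> 'h"
  assumes frame: "parseval_continuous_frame smul ip \<mu> x \<tau>"
begin

section \<open>Reconstruction formula and lower bound for the analysis operator\<close>

lemma has_weak_integral_unique:
  assumes "has_weak_integral ip M F v" "has_weak_integral ip M F w"
  shows "v = w"
proof -
  have "ip (v - w) (v - w) = 0"
    using assms by (simp add: has_weak_integral_def ip_diff_left)
  then show ?thesis by (simp add: ip_self_eq_0)
qed

text \<open>Existence from the frame conditions and uniqueness resolve the definite description in
  \<open>weak_integral\<close>; the Parseval condition then identifies its value with
  \<open>h\<close>.\<close>

lemma has_weak_integral_frame: "has_weak_integral ip \<mu> (\<lambda>\<alpha>. smul (ip h (x \<alpha>)) (\<tau> \<alpha>)) h"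
proof -
  obtain v where v: "has_weak_integral ip \<mu> (\<lambda>\<alpha>. smul (ip h (x \<alpha>)) (\<tau> \<alpha>)) v"
    using frame unfolding parseval_continuous_frame_def continuous_frame_def by blast
  then have "frame_op smul ip \<mu> x \<tau> h = v"
    unfolding frame_op_def weak_integral_def
    by (rule the_equality) (rule has_weak_integral_unique[OF _ v])
  then show ?thesis
    using v frame by (simp add: parseval_continuous_frame_def)
qed

lemma integrable_frame: "integrable \<mu> (\<lambda>\<alpha>. ip h (x \<alpha>) * ip (\<tau> \<alpha>) u)"
  and ip_eq_integral: "ip h u = (\<integral>\<alpha>. ip h (x \<alpha>) * ip (\<tau> \<alpha>) u \<partial>\<mu>)"
  using has_weak_integral_frame[of h] unfolding has_weak_integral_def ip_smul_left by blast+

lemma eq_0_if_orthogonal: "(\<And>\<alpha>. ip h (x \<alpha>) = 0) \<Longrightarrow> h = 0"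
  by (subst ip_self_eq_0[symmetric], subst ip_eq_integral) simp

lemma square_integrable_ip: "square_integrable \<mu> (\<lambda>\<alpha>. ip h (x \<alpha>))"
    "square_integrable \<mu> (\<lambda>\<alpha>. ip h (\<tau> \<alpha>))"
  using frame unfolding parseval_continuous_frame_def continuous_frame_def
    bounded_klinear_into_L2_def analysis_op_def by blast+

text \<open>The reconstruction formula writes the squared norm of \<open>v\<close> as a pairing of
  its two analysis transforms. A weighted arithmetic-geometric mean inequality splits the pairing,
  and boundedness of the transform by \<open>\<tau>\<close> lets its share be absorbed on the
  left.\<close>

lemma norm_sq_le_analysis:
  obtains c where "\<And>v. (norm v)\<^sup>2 \<le> c * (\<integral>\<alpha>. (norm (ip v (x \<alpha>)))\<^sup>2 \<partial>\<mu>)"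
proof -
  obtain C where C: "\<And>v. L2_norm \<mu> (\<lambda>\<alpha>. ip v (\<tau> \<alpha>)) \<le> C * norm v"
    using frame unfolding parseval_continuous_frame_def continuous_frame_def
      bounded_klinear_into_L2_def analysis_op_def by blast
  \<comment> \<open>The weight dominates \<open>C\<^sup>2\<close>, so that \<open>?T / c\<close>
    costs at most one of the two copies of \<open>(norm v)\<^sup>2\<close>; the 1 makes it
    positive.\<close>
  define c where "c = 1 + C\<^sup>2"
  have "c > 0" by (simp add: c_def add_pos_nonneg)
  have "(norm v)\<^sup>2 \<le> c * (\<integral>\<alpha>. (norm (ip v (x \<alpha>)))\<^sup>2 \<partial>\<mu>)" for v
  proof -
    let ?X = "\<integral>\<alpha>. (norm (ip v (x \<alpha>)))\<^sup>2 \<partial>\<mu>" and ?T = "\<integral>\<alpha>. (norm (ip v (\<tau> \<alpha>)))\<^sup>2 \<partial>\<mu>"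
    have "sqrt ?T \<le> C * norm v" using C[of v] by (simp add: L2_norm_def)
    moreover have "0 \<le> ?T" by simp
    ultimately have "?T \<le> (C * norm v)\<^sup>2"
      by (metis power_mono real_sqrt_ge_zero real_sqrt_pow2)
    also have "\<dots> \<le> c * (norm v)\<^sup>2"
      by (simp add: c_def power_mult_distrib algebra_simps)
    finally have T: "?T / c \<le> (norm v)\<^sup>2"
      using \<open>c > 0\<close> by (simp add: field_simps)
    have "2 * (norm v)\<^sup>2 = 2 * norm (\<integral>\<alpha>. ip v (x \<alpha>) * ip (\<tau> \<alpha>) v \<partial>\<mu>)"
      unfolding ip_eq_integral[symmetric] by (simp add: ip_self del: of_real_power)
    also have "\<dots> \<le> (\<integral>\<alpha>. 2 * norm (ip v (x \<alpha>) * ip (\<tau> \<alpha>) v) \<partial>\<mu>)"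
      by (simp add: integral_norm_bound)
    also have "\<dots> \<le> (\<integral>\<alpha>. c * (norm (ip v (x \<alpha>)))\<^sup>2 + (norm (ip v (\<tau> \<alpha>)))\<^sup>2 / c \<partial>\<mu>)"
    proof (rule integral_mono)
      show "integrable \<mu> (\<lambda>\<alpha>. 2 * norm (ip v (x \<alpha>) * ip (\<tau> \<alpha>) v))"
        by (intro integrable_mult_right integrable_norm integrable_frame)
      show "integrable \<mu> (\<lambda>\<alpha>. c * (norm (ip v (x \<alpha>)))\<^sup>2 + (norm (ip v (\<tau> \<alpha>)))\<^sup>2 / c)"
        using square_integrable_ip[of v] by (simp add: square_integrable_def)
      fix \<alpha>
      have "0 \<le> (c * norm (ip v (x \<alpha>)) - norm (ip v (\<tau> \<alpha>)))\<^sup>2 / c"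
        using \<open>c > 0\<close> by simp
      also have "\<dots> = c * (norm (ip v (x \<alpha>)))\<^sup>2 + (norm (ip v (\<tau> \<alpha>)))\<^sup>2 / c
          - 2 * (norm (ip v (x \<alpha>)) * norm (ip v (\<tau> \<alpha>)))"
        using \<open>c > 0\<close> by (simp add: field_simps power2_eq_square)
      finally show "2 * norm (ip v (x \<alpha>) * ip (\<tau> \<alpha>) v)
          \<le> c * (norm (ip v (x \<alpha>)))\<^sup>2 + (norm (ip v (\<tau> \<alpha>)))\<^sup>2 / c"
        by (simp add: norm_mult norm_ip_commute[of "\<tau> \<alpha>"])
    qed
    also have "\<dots> = c * ?X + ?T / c"
      using square_integrable_ip[of v] by (simp add: square_integrable_def)
    finally show ?thesis using T by simp
  qed
  then show thesis by (rule that)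
qed

text \<open>\<open>w\<close> plays the role of \<open>\<pi>\<^sub>g h\<close>: taking adjoints in \<open>x\<^sub>p = \<pi>\<^sub>g x\<^bsub>-g+p\<^esub>\<close> gives these equations.\<close>

definition translate_of :: "'g \<Rightarrow> 'h \<Rightarrow> 'h \<Rightarrow> bool" where
  "translate_of g h w \<longleftrightarrow>
     (\<forall>p. ip w (x p) = ip h (x (- g + p)) \<and> ip w (\<tau> p) = ip h (\<tau> (- g + p)))"

section \<open>Solutions of the translation equations\<close>

lemma translate_of_unique: "translate_of g h w \<Longrightarrow> translate_of g h w' \<Longrightarrow> w = w'"
  using eq_0_if_orthogonal[of "w - w'"] by (simp add: translate_of_def ip_diff_left)

lemma translate_of_add:
  "translate_of g h w \<Longrightarrow> translate_of g h' w' \<Longrightarrow> translate_of g (h + h') (w + w')"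
  by (simp add: translate_of_def ip_add_left)

lemma translate_of_diff:
  "translate_of g h w \<Longrightarrow> translate_of g h' w' \<Longrightarrow> translate_of g (h - h') (w - w')"
  by (simp add: translate_of_def ip_diff_left)

lemma translate_of_smul: "translate_of g h w \<Longrightarrow> translate_of g (smul c h) (smul c w)"
  by (simp add: translate_of_def ip_smul_left)

lemma translate_of_0: "translate_of 0 h h"
  by (simp add: translate_of_def)

text \<open>The order \<open>g' + g\<close> is forced: negation reverses sums in a noncommutative
  group.\<close>

lemma translate_of_trans:
  "translate_of g h w \<Longrightarrow> translate_of g' w u \<Longrightarrow> translate_of (g' + g) h u"
  by (simp add: translate_of_def minus_add add.assoc del: add_uminus_conv_diff)

text \<open>The reconstruction formula expands the left side through the
  \<open>x\<close>-coefficients of \<open>w\<close> and the \<open>\<tau>\<close>-coefficients of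
  \<open>w'\<close>; both are shifted by \<open>- g\<close>, and left invariance removes the
  shift.\<close>

lemma translate_of_ip:
  assumes "translate_of g h w" "translate_of g h' w'"
  shows "ip w w' = ip h h'"
proof -
  have "ip w w' = (\<integral>\<alpha>. ip w (x \<alpha>) * ip (\<tau> \<alpha>) w' \<partial>\<mu>)" by (rule ip_eq_integral)
  also have "\<dots> = (\<integral>\<alpha>. ip h (x (- g + \<alpha>)) * ip (\<tau> (- g + \<alpha>)) h' \<partial>\<mu>)"
    using assms unfolding translate_of_def
    by (intro Bochner_Integration.integral_cong) (simp_all add: ip_commute[of "\<tau> _"])
  also have "\<dots> = ip h h'"
    unfolding ip_eq_integral[of h h']
    by (rule integral_translation) (rule borel_measurable_integrable[OF integrable_frame])
  finally show ?thesis .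
qed

lemma translate_of_norm: "translate_of g h w \<Longrightarrow> norm w = norm h"
  using translate_of_ip[of g h w h w] unfolding ip_self of_real_eq_iff
  by (simp add: power2_eq_iff_nonneg)

lemma translate_of_exists:
  assumes x: "\<And>p. \<exists>w. translate_of g (x p) w"
  shows "\<exists>w. translate_of g h w"
proof -
  let ?S = "{h. \<exists>w. translate_of g h w}"
  have "?S = UNIV"
  proof (rule closed_subspace_eq_UNIV)
    show "closed ?S"
      unfolding closed_sequential_limits
    proof (intro allI impI, elim conjE)
      fix h l assume h: "\<forall>n. h n \<in> ?S" and l: "h \<longlonglongrightarrow> l"
      then obtain w where w: "\<And>n. translate_of g (h n) (w n)"
        by (auto simp: choice_iff)
      \<comment> \<open>Differences of solutions are solutions, hence isometric images; convergence
        of \<open>h\<close> thus forces \<open>w\<close> to be Cauchy.\<close>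
      have "dist (w m) (w n) = dist (h m) (h n)" for m n
        unfolding dist_norm by (rule translate_of_norm[OF translate_of_diff[OF w w]])
      then have "Cauchy w"
        using LIMSEQ_imp_Cauchy[OF l] by (simp add: Cauchy_def)
      then obtain k where k: "w \<longlonglongrightarrow> k"
        using Cauchy_convergent_iff convergent_def by blast
      have "translate_of g l k"
        unfolding translate_of_def
      proof (intro allI conjI)
        fix p
        show "ip k (x p) = ip l (x (- g + p))"
          using LIMSEQ_unique[OF tendsto_ip_left[OF k, of "x p"]] w
            tendsto_ip_left[OF l, of "x (- g + p)"] by (simp add: translate_of_def)
        show "ip k (\<tau> p) = ip l (\<tau> (- g + p))"
          using LIMSEQ_unique[OF tendsto_ip_left[OF k, of "\<tau> p"]] w
            tendsto_ip_left[OF l, of "\<tau> (- g + p)"] by (simp add: translate_of_def)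
      qed
      then show "l \<in> ?S" by blast
    qed
    show "?S \<noteq> {}" using x by blast
    show "v = 0" if "\<And>s. s \<in> ?S \<Longrightarrow> ip v s = 0" for v
      using that x by (intro eq_0_if_orthogonal) blast
  qed (auto intro: translate_of_add translate_of_smul)
  then show ?thesis by blast
qed

section \<open>Strong continuity and the representation\<close>

lemma tendsto_translate:
  assumes "\<And>g. translate_of g h (\<pi> g)"
  shows "(\<pi> \<longlongrightarrow> h) (nhds 0)"
proof -
  obtain c where c: "\<And>v. (norm v)\<^sup>2 \<le> c * (\<integral>\<alpha>. (norm (ip v (x \<alpha>)))\<^sup>2 \<partial>\<mu>)"
    using norm_sq_le_analysis by blast
  let ?D = "\<lambda>g. \<integral>\<alpha>. (norm (ip h (x (- g + \<alpha>)) - ip h (x \<alpha>)))\<^sup>2 \<partial>\<mu>"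
  \<comment> \<open>The \<open>x\<close>-coefficients of \<open>\<pi> g h - h\<close>, written
    \<open>\<pi> g - h\<close> here, are those of \<open>h\<close> translated minus those of
    \<open>h\<close>.\<close>
  have bound: "(norm (\<pi> g - h))\<^sup>2 \<le> c * ?D g" for g
    using c[of "\<pi> g - h"] assms[of g] by (simp add: translate_of_def ip_diff_left)
  have "((\<lambda>g. c * ?D g) \<longlongrightarrow> 0) (nhds 0)"
    using translation_continuous_square_integrable[OF square_integrable_ip(1)[of h]]
    unfolding translation_continuous_def by (rule tendsto_mult_right_zero)
  then have "((\<lambda>g. (norm (\<pi> g - h))\<^sup>2) \<longlongrightarrow> 0) (nhds 0)"
    by (rule Lim_null_comparison[rotated])
      (intro always_eventually allI, simp only: real_norm_def abs_power2 bound)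
  then have "((\<lambda>g. sqrt ((norm (\<pi> g - h))\<^sup>2)) \<longlongrightarrow> sqrt 0) (nhds 0)"
    by (rule tendsto_real_sqrt)
  then have "((\<lambda>g. norm (\<pi> g - h)) \<longlongrightarrow> 0) (nhds 0)" by simp
  then show ?thesis
    unfolding tendsto_norm_zero_iff by (simp add: LIM_zero_iff)
qed

text \<open>Each algebraic law holds because both of its sides solve the same translation equations,
  whose solution is unique.\<close>

lemma unitary_representation_translate:
  assumes \<pi>: "\<And>g h. translate_of g h (\<pi> g h)"
  shows "unitary_representation smul ip \<pi>"
proof -
  have zero: "\<pi> 0 h = h" for h
    by (rule translate_of_unique[OF \<pi> translate_of_0])
  have hom: "\<pi> (g + k) h = \<pi> g (\<pi> k h)" for g k h
    by (rule translate_of_unique[OF \<pi> translate_of_trans[OF \<pi> \<pi>]])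
  have add: "\<pi> g (h + k) = \<pi> g h + \<pi> g k" for g h k
    by (rule translate_of_unique[OF \<pi> translate_of_add[OF \<pi> \<pi>]])
  have diff: "\<pi> g (h - k) = \<pi> g h - \<pi> g k" for g h k
    by (rule translate_of_unique[OF \<pi> translate_of_diff[OF \<pi> \<pi>]])
  have smul: "\<pi> g (smul c h) = smul c (\<pi> g h)" for g c h
    by (rule translate_of_unique[OF \<pi> translate_of_smul[OF \<pi>]])
  have norm: "norm (\<pi> g h) = norm h" for g h
    by (rule translate_of_norm[OF \<pi>])
  have bounded: "bounded_klinear smul (\<pi> g)" for g
    unfolding bounded_klinear_def
  proof (intro conjI allI)
    show "bounded_linear (\<pi> g)"
      using smul[of g "of_real _"] unfolding smul_of_real
      by (intro bounded_linear_intro[of _ 1]) (simp_all add: add norm)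
  qed (rule smul)
  have inv: "\<pi> (- g) \<circ> \<pi> g = id" "\<pi> g \<circ> \<pi> (- g) = id" for g
    by (auto simp: zero simp flip: hom)
  have "is_adjoint ip (\<pi> g) (\<pi> (- g))" for g
    unfolding is_adjoint_def
  proof (intro allI)
    fix u v
    \<comment> \<open>Here \<open>v\<close> is written as an image under \<open>\<pi> g\<close>, so
      that preservation of inner products gives the adjoint.\<close>
    have "ip (\<pi> g u) (\<pi> g (\<pi> (- g) v)) = ip u (\<pi> (- g) v)"
      by (rule translate_of_ip[OF \<pi> \<pi>])
    then show "ip (\<pi> g u) v = ip u (\<pi> (- g) v)"
      using inv(2)[of g] by (simp add: fun_eq_iff)
  qed
  then have "unitary_op smul ip (\<pi> g)" for g
    unfolding unitary_op_def using bounded inv by blast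
  moreover have "continuous_on UNIV (\<lambda>g. \<pi> g v)" for v
    unfolding continuous_on_def
  proof (intro ballI)
    fix g :: 'g
    \<comment> \<open>Continuity at \<open>g\<close> is moved to the neutral element:
      \<open>- g + k\<close> tends to 0, and the isometry \<open>\<pi> g\<close> carries the
      estimate back.\<close>
    have "((+) (- g) \<longlongrightarrow> - g + g) (at g)"
      by (intro tendsto_intros)
    then have "((\<lambda>k. \<pi> (- g + k) v) \<longlongrightarrow> v) (at g)"
      using filterlim_compose[OF tendsto_translate[OF \<pi>, of v]] by simp
    then have "((\<lambda>k. norm (\<pi> (- g + k) v - v)) \<longlongrightarrow> 0) (at g)"
      by (simp add: LIM_zero_iff tendsto_norm_zero_iff)
    moreover have "norm (\<pi> (- g + k) v - v) = norm (\<pi> k v - \<pi> g v)" for k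
    proof -
      have "\<pi> g (\<pi> (- g + k) v - v) = \<pi> k v - \<pi> g v"
        by (simp add: diff flip: hom)
      then show ?thesis using norm[of g] by metis
    qed
    ultimately show "((\<lambda>g. \<pi> g v) \<longlongrightarrow> \<pi> g v) (at g)"
      by (simp add: LIM_zero_iff tendsto_norm_zero_iff)
  qed
  ultimately show ?thesis
    unfolding unitary_representation_def using hom by (auto simp: fun_eq_iff)
qed

end

section \<open>Orbits of a representation and invariance of the Gram kernels\<close>

theorem theorem6p31:
  fixes smul :: "'k::rc_field \<Rightarrow> 'h::banach \<Rightarrow> 'h"
    and ip :: "'h \<Rightarrow> 'h \<Rightarrow> 'k"
    and \<mu> :: "'g::{topological_group_add, t2_space} measure"
    and x \<tau> :: "'g \<Rightarrow> 'h"
  assumes "hilbert_space smul ip"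
    and "locally_compact_space (euclidean :: 'g topology)"
    and "left_haar_measure \<mu>"
    and "parseval_continuous_frame smul ip \<mu> x \<tau>"
  shows "(\<exists>\<pi> :: 'g \<Rightarrow> 'h \<Rightarrow> 'h. unitary_representation smul ip \<pi> \<and>
            (\<forall>g. x g = \<pi> g (x 0) \<and> \<tau> g = \<pi> g (\<tau> 0))) \<longleftrightarrow>
         (\<forall>g p q. ip (x (g + p)) (x (g + q)) = ip (x p) (x q) \<and>
            ip (x (g + p)) (\<tau> (g + q)) = ip (x p) (\<tau> q) \<and>
            ip (\<tau> (g + p)) (\<tau> (g + q)) = ip (\<tau> p) (\<tau> q))"
    (is "?rep \<longleftrightarrow> ?gram")
proof
  assume ?rep
  then obtain \<pi> where \<pi>: "unitary_representation smul ip \<pi>"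
    and "\<forall>g. x g = \<pi> g (x 0) \<and> \<tau> g = \<pi> g (\<tau> 0)" by blast
  then have orbit: "x (g + p) = \<pi> g (x p)" "\<tau> (g + p) = \<pi> g (\<tau> p)" for g p
    unfolding unitary_representation_def by (metis comp_apply)+
  \<comment> \<open>The adjoint of a unitary operator is also its left inverse.\<close>
  have "ip (\<pi> g u) (\<pi> g v) = ip u v" for g u v
    using \<pi> unfolding unitary_representation_def unitary_op_def is_adjoint_def
    by (metis comp_apply id_apply)
  then show ?gram by (simp add: orbit)
next
  assume gram: ?gram
  interpret parseval_frame smul ip \<mu> x \<tau>
    using assms by (simp add: parseval_frame_def parseval_frame_axioms_def left_haar_def)
  have gram': "ip (\<tau> (g + p)) (x (g + q)) = ip (\<tau> p) (x q)" for g p q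
    using gram ip_commute by metis
  have tx: "translate_of g (x p) (x (g + p))" for g p
    unfolding translate_of_def
  proof (intro allI)
    fix q
    show "ip (x (g + p)) (x q) = ip (x p) (x (- g + q)) \<and>
        ip (x (g + p)) (\<tau> q) = ip (x p) (\<tau> (- g + q))"
      \<comment> \<open>With \<open>q\<close> read as \<open>g + (- g + q)\<close>, the Gram
        identities are exactly the translation equations.\<close>
      using gram[rule_format, of g p "- g + q"] by (simp only: add_minus_cancel)
  qed
  have t\<tau>: "translate_of g (\<tau> p) (\<tau> (g + p))" for g p
    unfolding translate_of_def
  proof (intro allI)
    fix q
    show "ip (\<tau> (g + p)) (x q) = ip (\<tau> p) (x (- g + q)) \<and>
        ip (\<tau> (g + p)) (\<tau> q) = ip (\<tau> p) (\<tau> (- g + q))"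
      using gram[rule_format, of g p "- g + q"] gram'[of g p "- g + q"]
      by (simp only: add_minus_cancel)
  qed
  have "\<exists>w. translate_of g h w" for g h
    by (rule translate_of_exists) (rule exI, rule tx)
  then obtain \<pi> where \<pi>: "\<And>g h. translate_of g h (\<pi> g h)" by metis
  \<comment> \<open>By \<open>tx\<close> and \<open>t\<tau>\<close> at \<open>p = 0\<close>, both
    sides solve the equations for \<open>x 0\<close> and for \<open>\<tau> 0\<close>,
    respectively.\<close>
  have "x g = \<pi> g (x 0)" "\<tau> g = \<pi> g (\<tau> 0)" for g
    using translate_of_unique[OF _ \<pi>] tx[of g 0] t\<tau>[of g 0] by auto
  then show ?rep using unitary_representation_translate[OF \<pi>] by blast
qed

end
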